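(* Let $p_1,p_2$ be different prime numbers, let $n_1,n_2,n_3$ be positive integers such that $n_1p_1$ is coprime with $n_2p_2$, and put $N=n_1n_2n_3p_1p_2$. Let $A,B,U,V,U',V',K_1,K_2\subseteq\mathbb{Z}_N$ be sets as defined in the context, such that the pair $(S,R)$ with $$S=A+B,\qquad R=(U+V'+K_1)\cup(U'+V+K_2)$$ is a Vuza canon of $\mathbb{Z}_N$. Suppose that there are two non-periodic sets $A'$ and $B'$ such that $A'$ is constructed by replacing some (distinct) non-zero elements $a_1,\dots,a_n\in A$ by their sums with some non-zero elements $u_1,\dots,u_n\in U$ (not necessarily different), $$A'=\left(A\setminus\{a_1,\dots,a_n\}\right)\cup\{u_1+a_1,\dots,u_n+a_n\},$$ and $B'$ is constructed by replacing some (distinct) non-zero elements $b_1,\dots,b_m\in B$ by their sums with some non-zero elements $v_1,\dots,v_m\in V$ (not necessarily different), $$B'=\left(B\setminus\{b_1,\dots,b_m\}\right)\cup\{v_1+b_1,\dots,v_m+b_m\}.$$ Then the pair $(S',R)$ with $S'=A'+B'$ is a Vuza canon of $\mathbb{Z}_N$.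
   Context: $\mathbb{Z}_N=\{0,1,\dots,N-1\}$ denotes the cyclic group of order $N$ (addition modulo $N$). For positive integers $k,a$, $k\mathbb{I}_a=\{0,\ k\bmod N,\ 2k\bmod N,\dots,(a-1)k\bmod N\}\subseteq\mathbb{Z}_N$. Sums of subsets are $X+Y=\{x+y:x\in X,y\in Y\}$. For non-empty subsets $S,R$ of a finite cyclic group $G$, $G=S\oplus R$ means that every $g\in G$ can be written uniquely as $g=s+r$ with $s\in S$, $r\in R$. A non-empty subset $T$ of $G$ is periodic if there is $g\in G$, $g\neq0$, with $T+g=T$; otherwise it is non-periodic. A Vuza canon of $G$ is a pair $(S,R)$ of non-empty subsets of $G$ such that $G=S\oplus R$ and neither $S$ nor $R$ is periodic. Definition of the sets. $H=n_3\mathbb{I}_{n_1p_1n_2p_2}$ (a subgroup of $\mathbb{Z}_N$); $K$ is a complete set of coset representatives for $\mathbb{Z}_N$ modulo $H$, and $K=K_1\cup K_2$ is a disjoint union; $$A=n_1p_1n_3\mathbb{I}_{n_2},\quad B=n_2p_2n_3\mathbb{I}_{n_1},\quad U=n_1n_2n_3p_1\mathbb{I}_{p_2},\quad V=n_1n_2n_3p_2\mathbb{I}_{p_1}.$$ The sets $U',V'$ are given by one of the following two constructions. (1) $U'=\alpha n_2n_3\mathbb{I}_{p_2}$ and $V'=\beta n_1n_3\mathbb{I}_{p_1}$ with $\alpha\in\{1,n_1,p_1\}$, $\beta\in\{1,n_2,p_2\}$. (2) $U'$ is obtained from $U$ by replacing some distinct non-zero elements $u$ of $U$, each by $u+b$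 for some non-zero $b\in B$ (the $b$'s for different $u$'s need not be different), and $V'$ is obtained from $V$ by replacing some distinct non-zero elements $v$ of $V$, each by $v+a$ for some non-zero $a\in A$ (the $a$'s need not be different). *)

theory Defs
  imports "HOL-Algebra.Elementary_Groups" "HOL-Computational_Algebra.Primes"
begin

text \<open>
  Groups are written multiplicatively as in HOL-Algebra: for \<open>integer_mod_group N\<close>, the operation
  \<open>\<otimes>\<close> is addition modulo \<open>N\<close>, \<open>\<one>\<close> is \<open>0\<close>, \<open>X <#> Y\<close> is the sumset \<open>X + Y\<close>, and \<open>T #> g\<close> is
  the translate \<open>T + g\<close>.
\<close>

text \<open>\<open>progression N k a\<close> is the set $k\mathbb{I}_a$ in $\mathbb{Z}_N$.\<close>

definition progression :: "nat \<Rightarrow> nat \<Rightarrow> nat \<Rightarrow> int set" where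
  "progression N k a = (\<lambda>i. int (i * k) mod int N) ` {..<a}"

definition direct_sum_decomp :: "('a, 'b) monoid_scheme \<Rightarrow> 'a set \<Rightarrow> 'a set \<Rightarrow> bool" where
  "direct_sum_decomp G S R \<longleftrightarrow>
     S \<subseteq> carrier G \<and> R \<subseteq> carrier G \<and> S \<noteq> {} \<and> R \<noteq> {} \<and>
     (\<forall>g \<in> carrier G. \<exists>!p. p \<in> S \<times> R \<and> g = fst p \<otimes>\<^bsub>G\<^esub> snd p)"

text \<open>Periodicity is only meant for non-empty sets, hence the extra conjunct in \<open>nonperiodic\<close>.\<close>

definition periodic :: "('a, 'b) monoid_scheme \<Rightarrow> 'a set \<Rightarrow> bool" where
  "periodic G T \<longleftrightarrow> (\<exists>g \<in> carrier G. g \<noteq> \<one>\<^bsub>G\<^esub> \<and> T #>\<^bsub>G\<^esub> g = T)"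

definition nonperiodic :: "('a, 'b) monoid_scheme \<Rightarrow> 'a set \<Rightarrow> bool" where
  "nonperiodic G T \<longleftrightarrow> T \<noteq> {} \<and> \<not> periodic G T"

definition vuza_canon :: "('a, 'b) monoid_scheme \<Rightarrow> 'a set \<Rightarrow> 'a set \<Rightarrow> bool" where
  "vuza_canon G S R \<longleftrightarrow> direct_sum_decomp G S R \<and> nonperiodic G S \<and> nonperiodic G R"

definition coset_representatives :: "('a, 'b) monoid_scheme \<Rightarrow> 'a set \<Rightarrow> 'a set \<Rightarrow> bool" where
  "coset_representatives G H K \<longleftrightarrow>
     K \<subseteq> carrier G \<and> (\<forall>C \<in> rcosets\<^bsub>G\<^esub> H. \<exists>!k. k \<in> K \<and> k \<in> C)"

text \<open>
  \<open>T'\<close> arises from \<open>T\<close> by replacing each element \<open>d\<close> of a set \<open>D\<close> of non-identity elements of \<open>T\<close> by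
  \<open>f d \<otimes> d\<close>, where \<open>f d\<close> is a non-identity element of \<open>Y\<close>; \<open>f\<close> need not be injective. \<open>D\<close> may be
  empty, in which case \<open>T' = T\<close>.
\<close>

definition replacement :: "('a, 'b) monoid_scheme \<Rightarrow> 'a set \<Rightarrow> 'a set \<Rightarrow> 'a set \<Rightarrow> bool" where
  "replacement G T Y T' \<longleftrightarrow>
     (\<exists>D f. D \<subseteq> T - {\<one>\<^bsub>G\<^esub>} \<and> f ` D \<subseteq> Y - {\<one>\<^bsub>G\<^esub>} \<and>
            T' = (T - D) \<union> (\<lambda>d. f d \<otimes>\<^bsub>G\<^esub> d) ` D)"

end

theory Submission
  imports Defs
begin

text \<open>
  Additively, let \<open>P\<close> and \<open>Q\<close> be the subgroups of \<open>\<int>\<^sub>N\<close> generated by \<open>n1 p1 n3\<close> and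
  \<open>n2 p2 n3\<close>. Coprimality makes \<open>H\<close> the internal direct product of \<open>P\<close> and \<open>Q\<close>. Moreover \<open>U\<close> is
  a subgroup of \<open>P\<close> with \<open>A\<close> as a set of representatives, and \<open>V\<close> is a subgroup of \<open>Q\<close> with
  \<open>B\<close> as a set of representatives. Replacing elements of \<open>A\<close> by translates along \<open>U\<close>
  leaves their cosets modulo \<open>U\<close> alone, so \<open>A' + U = A + U = P\<close>, and likewise \<open>B' + V = Q\<close>
  (\<open>replacement_set_mult_subgroup\<close>).

  The sets \<open>V'\<close> and \<open>U'\<close> enter only through the identities \<open>V' + P = V + P\<close> and
  \<open>U' + Q = U + Q\<close>. Under the second construction these again say that a replacement does not
  change cosets. Under the first, \<open>\<alpha>\<close> is prime to \<open>p2\<close> and \<open>\<beta>\<close> to \<open>p1\<close>, so that, for instance,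
  both \<open>V'\<close> and \<open>V\<close> run through the multiples of \<open>n1 n3\<close> modulo \<open>n1 n3 p1\<close>
  (\<open>progression_set_mult_multiples\<close>). Therefore
  \<open>A' + B' + U + V' = P + B' + V' = P + B' + V = P + Q = H\<close>, symmetrically
  \<open>A' + B' + U' + V = H\<close>, and adding \<open>K1\<close> and \<open>K2\<close> shows that \<open>(A' + B') + R\<close> is the whole
  group.

  Uniqueness of the representation costs nothing more: replacements do not enlarge a set, so
  \<open>|A' + B'| \<le> |A| |B| = |A + B|\<close>, and a sum that covers the group with no more
  pairs than the given factorisation \<open>(A + B, R)\<close> has is direct
  (\<open>direct_sum_decomp_replace_left\<close>). Finally \<open>A' + B'\<close> inherits non-periodicity from \<open>A' \<subseteq> P\<close>
  and \<open>B' \<subseteq> Q\<close>, because a period of a product set splits into periods of the factors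
  (\<open>nonperiodic_set_mult\<close>).
\<close>

section \<open>Product sets\<close>

lemma (in comm_group) set_mult_commute:
  assumes "X \<subseteq> carrier G" "Y \<subseteq> carrier G"
  shows "X <#> Y = Y <#> X"
proof -
  have "X <#> Y \<subseteq> Y <#> X" if "X \<subseteq> carrier G" "Y \<subseteq> carrier G" for X Y
  proof
    fix g assume "g \<in> X <#> Y"
    then obtain x y where "x \<in> X" "y \<in> Y" "g = x \<otimes> y"
      unfolding set_mult_def by blast
    moreover from this have "g = y \<otimes> x" using that m_comm by blast
    ultimately show "g \<in> Y <#> X" unfolding set_mult_def by blast
  qed
  then show ?thesis using assms by blast
qed

lemma (in comm_group) set_mult_interchange:
  assumes "X \<subseteq> carrier G" "Y \<subseteq> carrier G" "Z \<subseteq> carrier G" "W \<subseteq> carrier G"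
  shows "(X <#> Y) <#> (Z <#> W) = (X <#> Z) <#> (Y <#> W)"
proof -
  have "(X <#> Y) <#> (Z <#> W) \<subseteq> (X <#> Z) <#> (Y <#> W)"
    if "X \<subseteq> carrier G" "Y \<subseteq> carrier G" "Z \<subseteq> carrier G" "W \<subseteq> carrier G" for X Y Z W
  proof
    fix g assume "g \<in> (X <#> Y) <#> (Z <#> W)"
    then obtain x y z w where *: "x \<in> X" "y \<in> Y" "z \<in> Z" "w \<in> W"
      "g = (x \<otimes> y) \<otimes> (z \<otimes> w)"
      unfolding set_mult_def by blast
    then have "g = (x \<otimes> z) \<otimes> (y \<otimes> w)"
      using that by (simp add: subset_iff m_ac)
    with * show "g \<in> (X <#> Z) <#> (Y <#> W)"
      unfolding set_mult_def by blast
  qed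
  then show ?thesis using assms by (meson subset_antisym)
qed

lemma (in group) subset_set_mult_subgroup:
  assumes "X \<subseteq> carrier G" "subgroup Q G"
  shows "X \<subseteq> X <#> Q"
proof
  fix x assume "x \<in> X"
  moreover from this have "x = x \<otimes> \<one>" using assms(1) by auto
  ultimately show "x \<in> X <#> Q"
    using subgroup.one_closed[OF assms(2)] unfolding set_mult_def by blast
qed

lemma card_set_mult_le:
  assumes "finite X" "finite Y"
  shows "card (X <#>\<^bsub>G\<^esub> Y) \<le> card X * card Y"
proof -
  have "X <#>\<^bsub>G\<^esub> Y = (\<lambda>(x, y). x \<otimes>\<^bsub>G\<^esub> y) ` (X \<times> Y)"
    unfolding set_mult_def by auto
  then show ?thesis
    using assms by (metis card_cartesian_product card_image_le finite_cartesian_product)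
qed

text \<open>
  Equal products give \<open>x'\<^sup>-\<^sup>1 x = y' y\<^sup>-\<^sup>1\<close>, an element of \<open>P \<inter> Q\<close>.
\<close>

lemma (in comm_group) mult_eq_subgroups_iff:
  assumes P: "subgroup P G" and Q: "subgroup Q G" and PQ: "P \<inter> Q = {\<one>}"
    and mem: "x \<in> P" "x' \<in> P" "y \<in> Q" "y' \<in> Q"
  shows "x \<otimes> y = x' \<otimes> y' \<longleftrightarrow> x = x' \<and> y = y'"
proof
  assume eq: "x \<otimes> y = x' \<otimes> y'"
  have c: "x \<in> carrier G" "x' \<in> carrier G" "y \<in> carrier G" "y' \<in> carrier G"
    using mem subgroup.mem_carrier[OF P] subgroup.mem_carrier[OF Q] by simp_all
  have "inv x' \<otimes> x = inv x' \<otimes> (x \<otimes> y) \<otimes> inv y"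
    using c by (simp add: m_assoc)
  also have "\<dots> = y' \<otimes> inv y"
    using c by (simp add: eq m_assoc[symmetric])
  finally have d: "inv x' \<otimes> x = y' \<otimes> inv y" .
  have "inv x' \<otimes> x \<in> P" using mem P by (simp add: subgroup.m_closed subgroup.m_inv_closed)
  moreover have "inv x' \<otimes> x \<in> Q"
    unfolding d using mem Q by (simp add: subgroup.m_closed subgroup.m_inv_closed)
  ultimately have "inv x' \<otimes> x = \<one>" using PQ by blast
  then have "x = x'" using c by (metis inv_closed inv_inv inv_equality)
  then show "x = x' \<and> y = y'" using eq c by simp
qed simp

lemma (in comm_group) inj_on_mult_subgroups:
  assumes "subgroup P G" "subgroup Q G" "P \<inter> Q = {\<one>}" "X \<subseteq> P" "Y \<subseteq> Q"
  shows "inj_on (\<lambda>(x, y). x \<otimes> y) (X \<times> Y)"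
proof (rule inj_onI, clarify)
  fix x y x' y' assume "x \<in> X" "y \<in> Y" "x' \<in> X" "y' \<in> Y" "x \<otimes> y = x' \<otimes> y'"
  then show "x = x' \<and> y = y'"
    using mult_eq_subgroups_iff[OF assms(1-3)] assms(4,5) by blast
qed

lemma (in comm_group) card_set_mult_subgroups:
  assumes "subgroup P G" "subgroup Q G" "P \<inter> Q = {\<one>}" "X \<subseteq> P" "Y \<subseteq> Q"
  shows "card (X <#> Y) = card X * card Y"
proof -
  have "X <#> Y = (\<lambda>(x, y). x \<otimes> y) ` (X \<times> Y)"
    unfolding set_mult_def by auto
  then show ?thesis
    using card_image[OF inj_on_mult_subgroups[OF assms]] by (simp add: card_cartesian_product)
qed

text \<open>
  The left factor is the projection of the product set to \<open>P\<close> along \<open>Q\<close>; an empty right factor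
  would erase it.
\<close>

lemma (in comm_group) set_mult_left_factor_unique:
  assumes PQ: "subgroup P G" "subgroup Q G" "P \<inter> Q = {\<one>}"
    and sub: "X \<subseteq> P" "X' \<subseteq> P" "Y \<subseteq> Q" "Y' \<subseteq> Q"
    and ne: "Y \<noteq> {}" "Y' \<noteq> {}" and eq: "X <#> Y = X' <#> Y'"
  shows "X = X'"
proof -
  have "X \<subseteq> X'" if sub: "X \<subseteq> P" "X' \<subseteq> P" "Y \<subseteq> Q" "Y' \<subseteq> Q"
    and ne: "Y \<noteq> {}" and eq: "X <#> Y = X' <#> Y'" for X X' Y Y'
  proof
    fix x assume x: "x \<in> X"
    obtain y where y: "y \<in> Y" using ne by blast
    have "x \<otimes> y \<in> X' <#> Y'" using x y eq unfolding set_mult_def by blast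
    then obtain x' y' where "x' \<in> X'" "y' \<in> Y'" "x \<otimes> y = x' \<otimes> y'"
      unfolding set_mult_def by blast
    then show "x \<in> X'"
      using mult_eq_subgroups_iff[OF PQ, of x x' y y'] x y sub by (auto simp: subset_iff)
  qed
  from this[OF sub ne(1) eq] this[OF sub(2,1,4,3) ne(2) eq[symmetric]]
  show ?thesis by blast
qed

section \<open>Periods of product sets\<close>

lemma (in comm_group) set_mult_rcoset_mult:
  assumes "X \<subseteq> carrier G" "Y \<subseteq> carrier G" "p \<in> carrier G" "q \<in> carrier G"
  shows "(X <#> Y) #> (p \<otimes> q) = (X #> p) <#> (Y #> q)"
proof -
  have "(X <#> Y) <#> ({p} <#> {q}) = (X <#> {p}) <#> (Y <#> {q})"
    using assms by (intro set_mult_interchange) auto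
  then show ?thesis by (simp add: set_mult_def r_coset_def)
qed

text \<open>
  A period \<open>g\<close> of \<open>X Y\<close> moves a point of \<open>X Y\<close> to another one and so lies in \<open>P Q\<close>, say
  \<open>g = p q\<close>. Then \<open>X Y = (X p) (Y q)\<close>, and uniqueness of the factors makes \<open>p\<close> a period
  of \<open>X\<close> and \<open>q\<close> a period of \<open>Y\<close>.
\<close>

lemma (in comm_group) nonperiodic_set_mult:
  assumes P: "subgroup P G" and Q: "subgroup Q G" and PQ: "P \<inter> Q = {\<one>}"
    and X: "X \<subseteq> P" and Y: "Y \<subseteq> Q"
    and np: "nonperiodic G X" "nonperiodic G Y"
  shows "nonperiodic G (X <#> Y)"
  unfolding nonperiodic_def periodic_def
proof (intro conjI notI)
  obtain x0 y0 where x0: "x0 \<in> X" and y0: "y0 \<in> Y"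
    using np unfolding nonperiodic_def by blast
  then have xy0: "x0 \<otimes> y0 \<in> X <#> Y" unfolding set_mult_def by blast
  then show "X <#> Y = {} \<Longrightarrow> False" by simp
  assume "\<exists>g\<in>carrier G. g \<noteq> \<one> \<and> (X <#> Y) #> g = X <#> Y"
  then obtain g where g: "g \<in> carrier G" "g \<noteq> \<one>" and per: "(X <#> Y) #> g = X <#> Y"
    by blast
  note carr = subgroup.mem_carrier[OF P] subgroup.mem_carrier[OF Q]
  have XYc: "X \<subseteq> carrier G" "Y \<subseteq> carrier G" using X Y carr by auto
  have "x0 \<otimes> y0 \<otimes> g \<in> X <#> Y" using xy0 per unfolding r_coset_def by blast
  then obtain x y where x: "x \<in> X" and y: "y \<in> Y" and e: "x0 \<otimes> y0 \<otimes> g = x \<otimes> y"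
    unfolding set_mult_def by blast
  define p where "p = inv x0 \<otimes> x"
  define q where "q = inv y0 \<otimes> y"
  have c: "x0 \<in> carrier G" "y0 \<in> carrier G" "x \<in> carrier G" "y \<in> carrier G"
    using x0 y0 x y XYc by auto
  have p: "p \<in> P" and q: "q \<in> Q"
    unfolding p_def q_def using x0 y0 x y X Y P Q
    by (auto intro!: subgroup.m_closed subgroup.m_inv_closed)
  have "g = inv (x0 \<otimes> y0) \<otimes> (x \<otimes> y)"
    using c g e by (metis inv_solve_left m_closed)
  also have "\<dots> = p \<otimes> q"
    unfolding p_def q_def using c by (simp add: inv_mult m_ac)
  finally have gpq: "g = p \<otimes> q" .
  have pc: "p \<in> carrier G" "q \<in> carrier G" using p q carr by simp_all
  have Xp: "X #> p \<subseteq> P" and Yq: "Y #> q \<subseteq> Q"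
    using X Y p q P Q unfolding r_coset_def by (auto intro: subgroup.m_closed)
  have split: "(X #> p) <#> (Y #> q) = X <#> Y"
    using per set_mult_rcoset_mult[OF XYc pc] gpq by simp
  have ne: "X \<noteq> {}" "Y \<noteq> {}" "X #> p \<noteq> {}" "Y #> q \<noteq> {}"
    using x0 y0 unfolding r_coset_def by auto
  have "X #> p = X"
    by (rule set_mult_left_factor_unique[OF P Q PQ Xp X Yq Y ne(4,2) split])
  then have p1: "p = \<one>" using np(1) pc unfolding nonperiodic_def periodic_def by blast
  have "(Y #> q) <#> (X #> p) = Y <#> X"
    using split XYc Xp Yq carr by (metis set_mult_commute subset_iff)
  then have "Y #> q = Y"
    using set_mult_left_factor_unique[OF Q P _ Yq Y Xp X ne(3,1)] PQ by blast
  then have "q = \<one>" using np(2) pc unfolding nonperiodic_def periodic_def by blast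
  then show False using p1 g gpq by simp
qed

section \<open>Factorisations and counting\<close>

lemma (in monoid) direct_sum_decomp_iff_bij_betw:
  assumes "S \<subseteq> carrier G" "R \<subseteq> carrier G" "S \<noteq> {}" "R \<noteq> {}"
  shows "direct_sum_decomp G S R \<longleftrightarrow> bij_betw (\<lambda>(s, r). s \<otimes> r) (S \<times> R) (carrier G)"
proof
  assume d: "direct_sum_decomp G S R"
  show "bij_betw (\<lambda>(s, r). s \<otimes> r) (S \<times> R) (carrier G)"
    unfolding bij_betw_def
  proof
    show "inj_on (\<lambda>(s, r). s \<otimes> r) (S \<times> R)"
    proof (rule inj_onI)
      fix a b assume ab: "a \<in> S \<times> R" "b \<in> S \<times> R"
        and eq: "(\<lambda>(s, r). s \<otimes> r) a = (\<lambda>(s, r). s \<otimes> r) b"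
      have "fst a \<otimes> snd a \<in> carrier G" using ab assms(1,2) by (intro m_closed) auto
      moreover have "fst a \<otimes> snd a = fst b \<otimes> snd b" using eq by (simp add: case_prod_unfold)
      ultimately show "a = b" using d ab unfolding direct_sum_decomp_def by blast
    qed
    show "(\<lambda>(s, r). s \<otimes> r) ` (S \<times> R) = carrier G"
    proof
      show "carrier G \<subseteq> (\<lambda>(s, r). s \<otimes> r) ` (S \<times> R)"
        using d unfolding direct_sum_decomp_def case_prod_unfold by blast
    qed (use assms in auto)
  qed
next
  assume b: "bij_betw (\<lambda>(s, r). s \<otimes> r) (S \<times> R) (carrier G)"
  have "\<exists>!p. p \<in> S \<times> R \<and> g = fst p \<otimes> snd p" if "g \<in> carrier G" for g
  proof -
    have inj: "inj_on (\<lambda>p. fst p \<otimes> snd p) (S \<times> R)"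
      and img: "(\<lambda>p. fst p \<otimes> snd p) ` (S \<times> R) = carrier G"
      using b unfolding bij_betw_def case_prod_unfold by simp_all
    obtain p where "p \<in> S \<times> R" "g = fst p \<otimes> snd p" using img \<open>g \<in> carrier G\<close> by blast
    then show ?thesis using inj_onD[OF inj] by (intro ex1I[of _ p]) simp_all
  qed
  with assms show "direct_sum_decomp G S R" unfolding direct_sum_decomp_def by blast
qed

text \<open>
  A surjection between finite sets whose domain is no larger than its codomain is injective; the
  given factorisation serves only to bound \<open>|S'| |R|\<close> by the order of the group.
\<close>

lemma (in monoid) direct_sum_decomp_replace_left:
  assumes d: "direct_sum_decomp G S R" and fin: "finite (carrier G)"
    and S': "S' \<subseteq> carrier G" "S' \<noteq> {}" and le: "card S' \<le> card S"
    and cover: "carrier G \<subseteq> S' <#> R"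
  shows "direct_sum_decomp G S' R"
proof -
  let ?m = "\<lambda>(s, r). s \<otimes> r"
  have sub: "S \<subseteq> carrier G" "R \<subseteq> carrier G" "S \<noteq> {}" "R \<noteq> {}"
    using d unfolding direct_sum_decomp_def by auto
  have finSR: "finite S'" "finite R" using sub S' fin finite_subset by blast+
  have "?m ` (S' \<times> R) = S' <#> R" unfolding set_mult_def by auto
  also have "\<dots> = carrier G"
    using cover S' sub unfolding set_mult_def by auto
  finally have img: "?m ` (S' \<times> R) = carrier G" .
  have "card (S' \<times> R) \<le> card (S \<times> R)" using le by (simp add: card_cartesian_product)
  also have "\<dots> = card (carrier G)"
    using d by (intro bij_betw_same_card) (simp add: direct_sum_decomp_iff_bij_betw[OF sub])
  finally have "card (S' \<times> R) \<le> card (?m ` (S' \<times> R))" using img by simp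
  then have "card (?m ` (S' \<times> R)) = card (S' \<times> R)"
    using card_image_le[of "S' \<times> R" ?m] finSR by simp
  then have "inj_on ?m (S' \<times> R)"
    using finSR by (intro eq_card_imp_inj_on) simp_all
  with img show ?thesis
    using direct_sum_decomp_iff_bij_betw[OF S'(1) sub(2) S'(2) sub(4)]
    unfolding bij_betw_def by simp
qed

section \<open>Replacements\<close>

lemma (in monoid) replacement_closed:
  assumes "replacement G T Y T'" "T \<subseteq> carrier G" "Y \<subseteq> carrier G"
  shows "T' \<subseteq> carrier G"
proof -
  obtain D f where D: "D \<subseteq> T - {\<one>}" and f: "f ` D \<subseteq> Y - {\<one>}"
    and T': "T' = (T - D) \<union> (\<lambda>d. f d \<otimes> d) ` D"
    using assms(1) unfolding replacement_def by blast
  have "f d \<otimes> d \<in> carrier G" if "d \<in> D" for d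
    using that D f assms(2,3) by (intro m_closed) blast+
  then show ?thesis using T' assms(2) by blast
qed

lemma card_replacement_le:
  assumes "replacement G T Y T'" "finite T"
  shows "card T' \<le> card T"
proof -
  obtain D f where D: "D \<subseteq> T - {\<one>\<^bsub>G\<^esub>}" and T': "T' = (T - D) \<union> (\<lambda>d. f d \<otimes>\<^bsub>G\<^esub> d) ` D"
    using assms(1) unfolding replacement_def by blast
  have fin: "finite D" "D \<subseteq> T" using D assms(2) by (auto intro: finite_subset)
  have "card T' \<le> card (T - D) + card ((\<lambda>d. f d \<otimes>\<^bsub>G\<^esub> d) ` D)"
    unfolding T' by (rule card_Un_le)
  also have "\<dots> \<le> card (T - D) + card D" using card_image_le[OF fin(1)] by simp
  also have "\<dots> = card T"
    using fin assms(2) by (simp add: card_Diff_subset card_mono)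
  finally show ?thesis .
qed

text \<open>
  A replaced element is multiplied by an element of \<open>Q\<close> and hence stays in its coset. The lemma is
  applied with \<open>Y\<close> equal to \<open>Q\<close> for the modified left factors, and with \<open>Y\<close> merely a
  subset of \<open>Q\<close> for the sets \<open>U'\<close> and \<open>V'\<close> of the second construction.
\<close>

lemma (in comm_group) replacement_set_mult_subgroup:
  assumes rep: "replacement G T Y T'" and T: "T \<subseteq> carrier G"
    and Q: "subgroup Q G" and Y: "Y \<subseteq> Q"
  shows "T' <#> Q = T <#> Q"
proof -
  obtain D f where D: "D \<subseteq> T - {\<one>}" and f: "f ` D \<subseteq> Y - {\<one>}"
    and T': "T' = (T - D) \<union> (\<lambda>d. f d \<otimes> d) ` D"
    using rep unfolding replacement_def by blast
  have fQ: "f d \<in> Q" "f d \<in> carrier G" "d \<in> carrier G" "d \<in> T" if "d \<in> D" for d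
  proof -
    show "f d \<in> Q" using that f Y by blast
    then show "f d \<in> carrier G" by (rule subgroup.mem_carrier[OF Q])
    show "d \<in> T" using that D by blast
    then show "d \<in> carrier G" using T by blast
  qed
  note Qc = subgroup.mem_carrier[OF Q]
  show ?thesis
  proof
    show "T' <#> Q \<subseteq> T <#> Q"
    proof
      fix g assume "g \<in> T' <#> Q"
      then obtain t q where t: "t \<in> T'" and q: "q \<in> Q" and g: "g = t \<otimes> q"
        unfolding set_mult_def by blast
      show "g \<in> T <#> Q"
      proof (cases "t \<in> T")
        case False
        then obtain d where d: "d \<in> D" "t = f d \<otimes> d" using t T' by blast
        then have "g = d \<otimes> (f d \<otimes> q)" using g fQ[OF d(1)] Qc[OF q] by (simp add: m_ac)
        moreover have "f d \<otimes> q \<in> Q" using fQ(1)[OF d(1)] q subgroup.m_closed[OF Q] by simp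
        ultimately show ?thesis using fQ(4)[OF d(1)] unfolding set_mult_def by blast
      qed (use q g in \<open>auto simp: set_mult_def\<close>)
    qed
    show "T <#> Q \<subseteq> T' <#> Q"
    proof
      fix g assume "g \<in> T <#> Q"
      then obtain t q where t: "t \<in> T" and q: "q \<in> Q" and g: "g = t \<otimes> q"
        unfolding set_mult_def by blast
      show "g \<in> T' <#> Q"
      proof (cases "t \<in> D")
        case True
        have "(f t \<otimes> t) \<otimes> (inv (f t) \<otimes> q) = (f t \<otimes> inv (f t)) \<otimes> (t \<otimes> q)"
          using fQ[OF True] Qc[OF q] by (simp only: m_ac inv_closed m_closed)
        then have "g = (f t \<otimes> t) \<otimes> (inv (f t) \<otimes> q)"
          using g fQ[OF True] Qc[OF q] by simp
        moreover have "inv (f t) \<otimes> q \<in> Q"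
          using fQ[OF True] q Q by (simp add: subgroup.m_closed subgroup.m_inv_closed)
        ultimately show ?thesis using True T' unfolding set_mult_def by blast
      next
        case False
        then have "t \<in> T'" using t T' by blast
        then show ?thesis using q g unfolding set_mult_def by blast
      qed
    qed
  qed
qed

section \<open>Exchanging the left factor\<close>

text \<open>
  The computation \<open>A B U V' = P B V' = P B V = P Q\<close>: once \<open>A U\<close> has been collected into the
  subgroup \<open>P\<close>, this subgroup absorbs the difference between \<open>V'\<close> and \<open>V\<close>.
\<close>

lemma (in comm_group) set_mult_exchange:
  assumes P: "subgroup P G" 
    and sub: "A \<subseteq> carrier G" "B \<subseteq> carrier G" "U \<subseteq> carrier G" "V \<subseteq> carrier G" "V' \<subseteq> carrier G"
    and AU: "A <#> U = P" and BV: "B <#> V = Q" and V': "V' <#> P = V <#> P"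
  shows "(A <#> B) <#> (U <#> V') = P <#> Q"
proof -
  note Pc = subgroup.subset[OF P]
  have "(A <#> B) <#> (U <#> V') = P <#> (B <#> V')"
    using set_mult_interchange sub AU by blast
  also have "\<dots> = B <#> (V' <#> P)"
    using sub Pc by (simp add: set_mult_commute[of P] set_mult_closed set_mult_assoc)
  also have "\<dots> = P <#> (B <#> V)"
    using sub Pc by (simp add: V' set_mult_commute[of P] set_mult_closed set_mult_assoc)
  finally show ?thesis using BV by simp
qed

text \<open>
  The abstract form of the theorem. It isolates what the arithmetic of the cyclic group has to
  supply: the four subgroups, the triviality of \<open>P \<inter> Q\<close>, the four product identities, and
  representatives modulo \<open>P Q\<close>. Exchanging the roles of \<open>P\<close> and \<open>Q\<close> turns the part of \<open>R\<close> over \<open>K1\<close> into the part over \<open>K2\<close>.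
\<close>

lemma (in comm_group) vuza_canon_exchange:
  assumes fin: "finite (carrier G)"
    and P: "subgroup P G" and Q: "subgroup Q G" and PQ: "P \<inter> Q = {\<one>}"
    and U: "subgroup U G" and V: "subgroup V G"
    and carr: "A \<subseteq> carrier G" "B \<subseteq> carrier G" "U' \<subseteq> carrier G" "V' \<subseteq> carrier G"
    and AU: "A <#> U = P" and BV: "B <#> V = Q"
    and V': "V' <#> P = V <#> P" and U': "U' <#> Q = U <#> Q"
    and K: "coset_representatives G (P <#> Q) (K1 \<union> K2)"
    and R: "R = (U <#> V' <#> K1) \<union> (U' <#> V <#> K2)"
    and canon: "vuza_canon G (A <#> B) R"
    and A': "replacement G A U A'" "nonperiodic G A'"
    and B': "replacement G B V B'" "nonperiodic G B'"
  shows "vuza_canon G (A' <#> B') R"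
proof -
  have UVc: "U \<subseteq> carrier G" "V \<subseteq> carrier G" using subgroup.subset[OF U] subgroup.subset[OF V] by simp_all
  have A'c: "A' \<subseteq> carrier G" and B'c: "B' \<subseteq> carrier G"
    using replacement_closed A' B' carr UVc by blast+
  have A'U: "A' <#> U = P" and B'V: "B' <#> V = Q"
    using replacement_set_mult_subgroup[OF A'(1) carr(1) U] AU
      replacement_set_mult_subgroup[OF B'(1) carr(2) V] BV by auto
  have in_PQ: "A \<subseteq> P" "B \<subseteq> Q" "A' \<subseteq> P" "B' \<subseteq> Q"
    using subset_set_mult_subgroup[OF _ U] subset_set_mult_subgroup[OF _ V] carr A'c B'c
      AU BV A'U B'V by blast+
  have cov1: "(A' <#> B') <#> (U <#> V') = P <#> Q"
    by (rule set_mult_exchange[OF P A'c B'c UVc carr(4) A'U B'V V'])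
  have cov2: "(A' <#> B') <#> (U' <#> V) = P <#> Q"
    using set_mult_exchange[OF Q B'c A'c UVc(2,1) carr(3) B'V A'U U']
      set_mult_commute[OF B'c A'c] set_mult_commute[OF UVc(2) carr(3)]
      set_mult_commute[OF subgroup.subset[OF Q] subgroup.subset[OF P]] by simp
  have Kc: "K1 \<subseteq> carrier G" "K2 \<subseteq> carrier G"
    using K unfolding coset_representatives_def by auto
  have PQc: "P \<subseteq> carrier G" "Q \<subseteq> carrier G" using subgroup.subset[OF P] subgroup.subset[OF Q] by simp_all
  have cover: "carrier G \<subseteq> (A' <#> B') <#> R"
  proof
    fix g assume g: "g \<in> carrier G"
    let ?H = "P <#> Q"
    have H: "?H \<subseteq> carrier G" using PQc by (rule set_mult_closed)
    have subH: "subgroup ?H G" using P Q by (simp add: mult_subgroups)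
    have "?H #> g \<in> rcosets ?H" using g unfolding RCOSETS_def by blast
    then obtain k where k: "k \<in> K1 \<union> K2" "k \<in> ?H #> g"
      using K unfolding coset_representatives_def by blast
    have "g \<in> ?H #> k"
      using k(2) g subH H by (metis repr_independence rcos_self)
    then obtain h where h: "h \<in> ?H" "g = h \<otimes> k" unfolding r_coset_def by blast
    have prod: "x \<otimes> y \<in> X <#> Y" if "x \<in> X" "y \<in> Y" for x y X Y
      using that unfolding set_mult_def by blast
    show "g \<in> (A' <#> B') <#> R"
    proof (cases "k \<in> K1")
      case True
      then have "g \<in> ((A' <#> B') <#> (U <#> V')) <#> K1"
        using h prod unfolding cov1 by simp
      then have "g \<in> (A' <#> B') <#> (U <#> V' <#> K1)"
        using A'c B'c UVc carr Kc by (simp add: set_mult_assoc set_mult_closed)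
      then show ?thesis using mono_set_mult[of "A' <#> B'" "A' <#> B'" _ R] R by blast
    next
      case False
      then have "g \<in> ((A' <#> B') <#> (U' <#> V)) <#> K2"
        using h prod k(1) unfolding cov2 by simp
      then have "g \<in> (A' <#> B') <#> (U' <#> V <#> K2)"
        using A'c B'c UVc carr Kc by (simp add: set_mult_assoc set_mult_closed)
      then show ?thesis using mono_set_mult[of "A' <#> B'" "A' <#> B'" _ R] R by blast
    qed
  qed
  have finAB: "finite A" "finite B" "finite A'" "finite B'"
    using carr A'c B'c finite_subset[OF _ fin] by simp_all
  have "card (A' <#> B') \<le> card A' * card B'" using finAB by (intro card_set_mult_le)
  also have "\<dots> \<le> card A * card B"
    using card_replacement_le[OF A'(1)] card_replacement_le[OF B'(1)] finAB by (simp add: mult_le_mono)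
  also have "\<dots> = card (A <#> B)"
    using card_set_mult_subgroups[OF P Q PQ in_PQ(1,2)] by simp
  finally have le: "card (A' <#> B') \<le> card (A <#> B)" .
  have np: "nonperiodic G (A' <#> B')"
    by (rule nonperiodic_set_mult[OF P Q PQ in_PQ(3,4) A'(2) B'(2)])
  have "direct_sum_decomp G (A' <#> B') R"
  proof (rule direct_sum_decomp_replace_left[OF _ fin _ _ le cover])
    show "direct_sum_decomp G (A <#> B) R" using canon unfolding vuza_canon_def by blast
    show "A' <#> B' \<subseteq> carrier G" using A'c B'c by (rule set_mult_closed)
    show "A' <#> B' \<noteq> {}" using np unfolding nonperiodic_def by blast
  qed
  then show ?thesis using np canon unfolding vuza_canon_def by blast
qed

section \<open>Multiples in the cyclic group\<close>

definition multiples :: "nat \<Rightarrow> nat \<Rightarrow> int set" where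
  "multiples N d = {x. 0 \<le> x \<and> x < int N \<and> int d dvd x}"

lemma subgroup_multiples:
  assumes "d dvd N" "0 < N"
  shows "subgroup (multiples N d) (integer_mod_group N)"
proof -
  interpret group "integer_mod_group N" by simp
  show ?thesis
  proof (rule subgroupI)
    show "multiples N d \<subseteq> carrier (integer_mod_group N)"
      using assms(2) by (auto simp: multiples_def carrier_integer_mod_group)
    have "0 \<in> multiples N d" using assms(2) by (simp add: multiples_def)
    then show "multiples N d \<noteq> {}" by blast
    show "inv\<^bsub>integer_mod_group N\<^esub> a \<in> multiples N d" if "a \<in> multiples N d" for a
      using that assms by (auto simp: multiples_def carrier_integer_mod_group inv_integer_mod_group dvd_mod_iff)
    show "a \<otimes>\<^bsub>integer_mod_group N\<^esub> b \<in> multiples N d"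
      if "a \<in> multiples N d" "b \<in> multiples N d" for a b
      using that assms by (auto simp: multiples_def mult_integer_mod_group dvd_mod_iff)
  qed
qed

lemma progression_closed:
  assumes "0 < N"
  shows "progression N k a \<subseteq> carrier (integer_mod_group N)"
  using assms by (auto simp: progression_def carrier_integer_mod_group)

lemma progression_full:
  assumes "N = d * a" "0 < N"
  shows "progression N d a = multiples N d"
proof
  show "progression N d a \<subseteq> multiples N d"
    using assms by (auto simp: progression_def multiples_def dvd_mod_iff)
  show "multiples N d \<subseteq> progression N d a"
  proof
    fix x assume "x \<in> multiples N d"
    then obtain j where x: "0 \<le> x" "x < int N" and j: "x = int d * j"
      unfolding multiples_def by blast
    have d: "0 < int d" using assms by simp
    have "0 \<le> j" using x(1) j d by (simp add: zero_le_mult_iff)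
    moreover have "j < int a" using x(2) j d assms(1) by simp
    ultimately have "nat j < a" "x = int (nat j * d) mod int N"
      using x j by (auto simp: mult.commute)
    then show "x \<in> progression N d a" unfolding progression_def by blast
  qed
qed

text \<open>
  Since \<open>c\<close> is invertible modulo \<open>m\<close>, the multiples \<open>0, c d, \<dots>, (m - 1) c d\<close> represent all
  classes of multiples of \<open>d\<close> modulo \<open>d m\<close>. This one fact yields \<open>A + U = P\<close>, \<open>B + V = Q\<close>
  and \<open>P + Q = H\<close>, as well as the independence of \<open>V' + P\<close> and \<open>U' + Q\<close> from the multipliers
  \<open>\<beta>\<close> and \<open>\<alpha>\<close> in the first construction.
\<close>

lemma progression_set_mult_multiples:
  assumes "d * m dvd N" "0 < N" "coprime c m"
  shows "progression N (c * d) m <#>\<^bsub>integer_mod_group N\<^esub> multiples N (d * m) = multiples N d"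
proof
  have d: "d dvd N" using assms(1) dvd_mult_left by blast
  show "progression N (c * d) m <#>\<^bsub>integer_mod_group N\<^esub> multiples N (d * m) \<subseteq> multiples N d"
    using assms(2) d
    by (auto simp: progression_def multiples_def set_mult_def mult_integer_mod_group dvd_mod_iff
        intro!: dvd_add intro: dvd_mult_left)
  show "multiples N d \<subseteq> progression N (c * d) m <#>\<^bsub>integer_mod_group N\<^esub> multiples N (d * m)"
  proof
    fix x assume "x \<in> multiples N d"
    then obtain y where x: "0 \<le> x" "x < int N" and y: "x = int d * y"
      unfolding multiples_def by blast
    have m: "0 < m" using assms(1,2) by (cases m) auto
    obtain e f where ef: "e * int c + f * int m = 1"
      using bezout_int[of "int c" "int m"] assms(3) by (auto simp: coprime_iff_gcd_eq_1)
    \<comment> \<open>\<open>e\<close> inverts \<open>c\<close> modulo \<open>m\<close>, so \<open>i\<close> solves \<open>c i \<equiv> y\<close> modulo \<open>m\<close>.\<close>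
    define i where "i = nat (e * y mod int m)"
    have i: "int i = e * y mod int m" "i < m"
      using m unfolding i_def by (simp_all add: nat_less_iff)
    have "int m dvd e * y - int i"
      unfolding i(1) by (simp add: minus_mod_eq_mult_div)
    then have "int m dvd int c * (e * y - int i) + f * y * int m"
      by (intro dvd_add dvd_mult) simp_all
    moreover have "y - int c * int i = (e * int c + f * int m) * y - int c * int i"
      unfolding ef by simp
    ultimately have "int m dvd y - int c * int i"
      by (simp add: algebra_simps)
    then have "int (d * m) dvd int d * (y - int c * int i)"
      by (simp add: mult_dvd_mono)
    then have r: "int (d * m) dvd x - int (i * (c * d))"
      by (simp add: y algebra_simps)
    let ?p = "int (i * (c * d)) mod int N"
    let ?q = "(x - int (i * (c * d))) mod int N"
    have "?p \<in> progression N (c * d) m" unfolding progression_def using i by blast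
    moreover have "?q \<in> multiples N (d * m)"
      using r assms(1,2) by (simp add: multiples_def dvd_mod_iff del: of_nat_mult)
    moreover have "x = ?p \<otimes>\<^bsub>integer_mod_group N\<^esub> ?q"
      using x by (simp add: mult_integer_mod_group mod_simps del: of_nat_mult)
    ultimately show "x \<in> progression N (c * d) m <#>\<^bsub>integer_mod_group N\<^esub> multiples N (d * m)"
      unfolding set_mult_def by blast
  qed
qed

lemma multiples_inter_coprime:
  assumes "coprime a b" "N = d * a * b"
  shows "multiples N (d * a) \<inter> multiples N (d * b) \<subseteq> {0}"
proof
  fix x assume "x \<in> multiples N (d * a) \<inter> multiples N (d * b)"
  then have x: "0 \<le> x" "x < int N" and "int d * int a dvd x" "int d * int b dvd x"
    unfolding multiples_def by auto
  then obtain y z where y: "x = int d * (int a * y)" and z: "x = int d * (int b * z)"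
    by (metis dvdE mult.assoc)
  have "int a dvd int b * z"
    using y z x assms(2) by (cases "d = 0") auto
  then have "int a dvd z"
    using assms(1) by (simp add: coprime_dvd_mult_right_iff)
  then have "int N dvd x" using z assms(2) by (auto simp: mult.assoc mult.left_commute)
  then show "x \<in> {0}" using x zdvd_not_zless[of x "int N"] by force
qed

section \<open>Vuza canons\<close>

theorem theorem20:
  fixes p1 p2 n1 n2 n3 N :: nat
    and G :: "int monoid" (structure)
    and H K K1 K2 A B U V U' V' S R A' B' :: "int set"
  assumes "prime p1" and "prime p2" and "p1 \<noteq> p2"
    and "n1 > 0" and "n2 > 0" and "n3 > 0"
    and "coprime (n1 * p1) (n2 * p2)"
    and "N = n1 * n2 * n3 * p1 * p2"
    and "G = integer_mod_group N"
    and "H = progression N n3 (n1 * p1 * n2 * p2)"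
    and "coset_representatives G H K"
    and "K = K1 \<union> K2" and "K1 \<inter> K2 = {}"
    and "A = progression N (n1 * p1 * n3) n2"
    and "B = progression N (n2 * p2 * n3) n1"
    and "U = progression N (n1 * n2 * n3 * p1) p2"
    and "V = progression N (n1 * n2 * n3 * p2) p1"
    and "(\<exists>\<alpha> \<in> {1, n1, p1}. \<exists>\<beta> \<in> {1, n2, p2}.
            U' = progression N (\<alpha> * n2 * n3) p2 \<and> V' = progression N (\<beta> * n1 * n3) p1) \<or>
         (replacement G U B U' \<and> replacement G V A V')"
    and "S = A <#> B"
    and "R = (U <#> V' <#> K1) \<union> (U' <#> V <#> K2)"
    and "vuza_canon G S R"
    and "replacement G A U A'" and "nonperiodic G A'"
    and "replacement G B V B'" and "nonperiodic G B'"
  shows "vuza_canon G (A' <#> B') R"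
proof -
  have N: "0 < N" using assms(1,2,4-6,8) by (simp add: prime_gt_0_nat)
  note Gdef = \<open>G = integer_mod_group N\<close>
  interpret comm_group G unfolding Gdef by simp
  have cop: "coprime n1 n2" "coprime n1 p2" "coprime p1 n2" "coprime p1 p2"
    using \<open>coprime (n1 * p1) (n2 * p2)\<close> by simp_all
  define P where "P = multiples N (n1 * p1 * n3)"
  define Q where "Q = multiples N (n2 * p2 * n3)"
  have Ueq: "U = multiples N (n1 * n2 * n3 * p1)" and Veq: "V = multiples N (n1 * n2 * n3 * p2)"
    unfolding \<open>U = _\<close> \<open>V = _\<close>
    by (intro progression_full; use N in \<open>simp add: assms(8)\<close>)+
  have P: "subgroup P G" and Q: "subgroup Q G" and U: "subgroup U G" and V: "subgroup V G"
    unfolding P_def Q_def Ueq Veq Gdef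
    by (rule subgroup_multiples; use N in \<open>simp add: assms(8)\<close>)+
  have AU: "A <#> U = P"
    using progression_set_mult_multiples[of "n1 * p1 * n3" n2 N 1] N
    unfolding \<open>A = _\<close> Ueq P_def Gdef by (simp add: assms(8) ac_simps)
  have BV: "B <#> V = Q"
    using progression_set_mult_multiples[of "n2 * p2 * n3" n1 N 1] N
    unfolding \<open>B = _\<close> Veq Q_def Gdef by (simp add: assms(8) ac_simps)
  have PQ: "P \<inter> Q = {\<one>}"
  proof -
    have "P \<inter> Q \<subseteq> {0}"
      using multiples_inter_coprime[OF assms(7), of N n3]
      unfolding P_def Q_def by (simp add: assms(8) ac_simps)
    moreover have "\<one> = 0" unfolding Gdef by simp
    ultimately show ?thesis
      using subgroup.one_closed[OF P] subgroup.one_closed[OF Q] by auto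
  qed
  \<comment> \<open>Read as a progression whose multiplier \<open>n2 p2\<close> is prime to \<open>n1 p1\<close>, \<open>Q\<close> represents
    \<open>H\<close> modulo \<open>P\<close>.\<close>
  have "Q = progression N (n2 * p2 * n3) (n1 * p1)"
    unfolding Q_def by (rule progression_full[symmetric]) (use N in \<open>simp_all add: assms(8)\<close>)
  then have "Q <#> P = multiples N n3"
    using progression_set_mult_multiples[of n3 "n1 * p1" N "n2 * p2"] N assms(7)
    unfolding P_def Gdef by (simp add: assms(8) ac_simps)
  also have "multiples N n3 = H"
    unfolding \<open>H = _\<close> by (rule progression_full[symmetric]) (use N in \<open>simp_all add: assms(8)\<close>)
  finally have H: "P <#> Q = H"
    using set_mult_commute[OF subgroup.subset[OF P] subgroup.subset[OF Q]] by simp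
  have carr: "A \<subseteq> carrier G" "B \<subseteq> carrier G" "U \<subseteq> carrier G" "V \<subseteq> carrier G"
    unfolding Gdef assms(14-17) by (intro progression_closed[OF N])+
  have sub: "A \<subseteq> P" "B \<subseteq> Q"
    using subset_set_mult_subgroup[OF carr(1) U] subset_set_mult_subgroup[OF carr(2) V] AU BV
    by simp_all
  \<comment> \<open>The right-hand sides do not depend on the multiplier; the multipliers \<open>n2 p2\<close> and \<open>n1 p1\<close>
    give back \<open>V\<close> and \<open>U\<close>.\<close>
  have modP: "progression N (c * n1 * n3) p1 <#> P = multiples N (n1 * n3)" if "coprime c p1" for c
    using progression_set_mult_multiples[OF _ N that, of "n1 * n3"]
    unfolding P_def Gdef by (simp add: assms(8) ac_simps)
  have modQ: "progression N (c * n2 * n3) p2 <#> Q = multiples N (n2 * n3)" if "coprime c p2" for c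
    using progression_set_mult_multiples[OF _ N that, of "n2 * n3"]
    unfolding Q_def Gdef by (simp add: assms(8) ac_simps)
  have VP: "V <#> P = multiples N (n1 * n3)" and UQ: "U <#> Q = multiples N (n2 * n3)"
    using modP[of "n2 * p2"] modQ[of "n1 * p1"] cop
    unfolding assms(16,17) by (simp_all add: ac_simps coprime_commute)
  have "U' \<subseteq> carrier G \<and> V' \<subseteq> carrier G \<and> V' <#> P = V <#> P \<and> U' <#> Q = U <#> Q"
    using assms(18)
  proof (elim disjE bexE conjE)
    fix \<alpha> \<beta> assume ab: "\<alpha> \<in> {1, n1, p1}" "\<beta> \<in> {1, n2, p2}"
      and U': "U' = progression N (\<alpha> * n2 * n3) p2" and V': "V' = progression N (\<beta> * n1 * n3) p1"
    have "coprime \<alpha> p2" "coprime \<beta> p1" using ab cop by (auto simp: coprime_commute)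
    then show ?thesis
      using modP modQ VP UQ progression_closed[OF N] unfolding U' V' Gdef by simp
  next
    assume rep: "replacement G U B U'" "replacement G V A V'"
    then show ?thesis
      using replacement_closed[OF rep(1) carr(3,2)] replacement_closed[OF rep(2) carr(4,1)]
        replacement_set_mult_subgroup[OF rep(1) carr(3) Q sub(2)]
        replacement_set_mult_subgroup[OF rep(2) carr(4) P sub(1)] by simp
  qed
  then have U'V': "U' \<subseteq> carrier G" "V' \<subseteq> carrier G" "V' <#> P = V <#> P" "U' <#> Q = U <#> Q"
    by simp_all
  show ?thesis
  proof (rule vuza_canon_exchange[OF _ P Q PQ U V carr(1,2) U'V'(1,2) AU BV U'V'(3,4) _ _ _ assms(22-25)])
    show "finite (carrier G)" unfolding Gdef using N by (simp add: carrier_integer_mod_group)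
    show "coset_representatives G (P <#> Q) (K1 \<union> K2)" using assms(11,12) H by simp
    show "vuza_canon G (A <#> B) R" using assms(19,21) by simp
  qed (rule assms(20))
qed

end
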